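(* For $k\in\mathbb{N}_0$ and $a>0$, \[ \int_0^\infty \frac{\ln x\,dx}{(x-1)(x+a)^{k+1}} = \frac{1}{(a+1)^{k+1}}\left(\frac{\pi^2+\ln^2 a}{2} + \sum_{j=0}^{k-1}\frac{(1+1/a)^{j+1}}{j+1}\,(H_j-\ln a)\right). \]
   Context: $H_n=\sum_{i=1}^n \frac1i$ denotes the $n$-th harmonic number, with $H_0=0$. Empty sums are zero. *)

theory Defs
  imports "HOL-Analysis.Analysis"
begin

end

theory Submission
  imports Defs "HOL-Real_Asymp.Real_Asymp"
begin

text \<open>
  Write \<open>I k a\<close> for the integral. Since \<open>(x + a) - (x - 1) = a + 1\<close>, partial fractions give
  \<open>(a + 1) I (k + 1) a = I k a - G k a\<close>, where \<open>G k a\<close> is the integral of \<open>ln x / (x + a)^(k + 2)\<close>,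
  which is elementary; this yields the sum over \<open>j\<close> by induction on \<open>k\<close>.
  For \<open>k = 0\<close>, differentiation under the integral gives \<open>I' 0 a = - I 1 a = - (I 0 a - ln a / a) / (a + 1)\<close>,
  so that \<open>(a + 1) I 0 a - (ln a)\<^sup>2 / 2\<close> does not depend on \<open>a\<close>. Its value is found at \<open>a = 1\<close>, where
  expanding \<open>1 / (x\<^sup>2 - 1)\<close> into a geometric series on each side of \<open>1\<close> leads to twice the sum of
  the inverse odd squares.
\<close>

section \<open>Fundamental theorem of calculus on open, possibly unbounded intervals\<close>

text \<open>For a nonnegative integrand, finite limits of \<open>F\<close> at both ends already
  force integrability. Extended real endpoints treat bounded and unbounded intervals at
  once.\<close>

lemma has_integral_FTC_nonneg_einterval:
  fixes f F :: "real \<Rightarrow> real" and a b :: ereal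
  assumes "a < b"
    and F: "\<And>x. a < ereal x \<Longrightarrow> ereal x < b \<Longrightarrow> (F has_real_derivative f x) (at x)"
    and f: "\<And>x. a < ereal x \<Longrightarrow> ereal x < b \<Longrightarrow> isCont f x"
    and nonneg: "\<And>x. a < ereal x \<Longrightarrow> ereal x < b \<Longrightarrow> 0 \<le> f x"
    and A: "((F \<circ> real_of_ereal) \<longlongrightarrow> A) (at_right a)"
    and B: "((F \<circ> real_of_ereal) \<longlongrightarrow> B) (at_left b)"
  shows "(f has_integral (B - A)) (einterval a b)"
proof -
  have int: "set_integrable lborel (einterval a b) f" and eq: "(LBINT x=a..b. f x) = B - A"
    using interval_integral_FTC_nonneg[OF \<open>a < b\<close> F f _ A B] nonneg by auto
  have "integral (einterval a b) f = B - A"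
    using set_borel_integral_eq_integral(2)[OF int] eq \<open>a < b\<close>
    by (simp add: interval_lebesgue_integral_def order_less_imp_le)
  then show ?thesis
    using set_borel_integral_eq_integral(1)[OF int] by (metis integrable_integral)
qed

lemma has_integral_FTC_nonneg_Ioo:
  fixes f F :: "real \<Rightarrow> real"
  assumes "a < b"
    and "\<And>x. a < x \<Longrightarrow> x < b \<Longrightarrow> (F has_real_derivative f x) (at x)"
    and "\<And>x. a < x \<Longrightarrow> x < b \<Longrightarrow> isCont f x"
    and "\<And>x. a < x \<Longrightarrow> x < b \<Longrightarrow> 0 \<le> f x"
    and "(F \<longlongrightarrow> A) (at_right a)" and "(F \<longlongrightarrow> B) (at_left b)"
  shows "(f has_integral (B - A)) {a<..<b}"
  using has_integral_FTC_nonneg_einterval[of "ereal a" "ereal b" F f A B] assms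
  by (simp add: ereal_tendsto_simps)

lemma has_integral_FTC_nonneg_Ioi:
  fixes f F :: "real \<Rightarrow> real"
  assumes "\<And>x. a < x \<Longrightarrow> (F has_real_derivative f x) (at x)"
    and "\<And>x. a < x \<Longrightarrow> isCont f x"
    and "\<And>x. a < x \<Longrightarrow> 0 \<le> f x"
    and "(F \<longlongrightarrow> A) (at_right a)" and "(F \<longlongrightarrow> B) at_top"
  shows "(f has_integral (B - A)) {a<..}"
  using has_integral_FTC_nonneg_einterval[of "ereal a" \<infinity> F f A B] assms
  by (simp add: ereal_tendsto_simps)

lemma has_integral_Ioi_split:
  fixes f :: "real \<Rightarrow> real"
  assumes "(f has_integral i) {a<..<b}" and "(f has_integral j) {b<..}" and "a < b"
  shows "(f has_integral (i + j)) {a<..}"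
proof -
  have "(f has_integral (i + j)) ({a<..<b} \<union> {b<..})"
    using assms by (intro has_integral_Un) (auto intro: negligible_subset[of "{}"])
  moreover have "negligible {x \<in> ({a<..<b} \<union> {b<..}) - {a<..}. f x \<noteq> 0}"
    using \<open>a < b\<close> by (auto intro: negligible_subset[of "{}"])
  moreover have "negligible {x \<in> {a<..} - ({a<..<b} \<union> {b<..}). f x \<noteq> 0}"
    by (rule negligible_subset[of "{b}"]) auto
  ultimately show ?thesis
    using has_integral_spike_set_eq by blast
qed

text \<open>Meant for \<open>ln x / (x + a) ^ (k + 2)\<close>, which changes sign at 1. The
  nonnegative case is applied to \<open>- f\<close> left of \<open>b\<close> and to \<open>f\<close>
  right of it; the values \<open>F b\<close> cancel.\<close>

lemma has_integral_FTC_sign_change_Ioi: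
  fixes f F :: "real \<Rightarrow> real"
  assumes "a < b"
    and F: "\<And>x. a < x \<Longrightarrow> (F has_real_derivative f x) (at x)"
    and f: "\<And>x. a < x \<Longrightarrow> isCont f x"
    and nonpos: "\<And>x. a < x \<Longrightarrow> x < b \<Longrightarrow> f x \<le> 0"
    and nonneg: "\<And>x. b < x \<Longrightarrow> 0 \<le> f x"
    and A: "(F \<longlongrightarrow> A) (at_right a)" and B: "(F \<longlongrightarrow> B) at_top"
  shows "(f has_integral (B - A)) {a<..}"
proof -
  have "isCont F b"
    using F \<open>a < b\<close> DERIV_isCont by blast
  then have lim: "(F \<longlongrightarrow> F b) (at_left b)" "(F \<longlongrightarrow> F b) (at_right b)"
    by (auto simp: isCont_def filterlim_at_split)
  have "((\<lambda>x. - f x) has_integral (- F b - - A)) {a<..<b}"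
    using assms lim
    by (intro has_integral_FTC_nonneg_Ioo[where F = "\<lambda>x. - F x"])
       (auto intro!: derivative_eq_intros tendsto_minus)
  from has_integral_neg[OF this] have "(f has_integral (F b - A)) {a<..<b}"
    by simp
  moreover have "(f has_integral (B - F b)) {b<..}"
    using assms lim by (intro has_integral_FTC_nonneg_Ioi[where F = F]) auto
  ultimately show ?thesis
    using has_integral_Ioi_split[of f "F b - A" a b "B - F b"] \<open>a < b\<close> by simp
qed

section \<open>Integrals of \<open>ln x\<close> times powers of \<open>x\<close>\<close>

lemma has_integral_power_mult_ln_01:
  "((\<lambda>x::real. - (x ^ m * ln x)) has_integral (1 / (real m + 1)\<^sup>2)) {0<..<1}"
proof -
  \<comment> \<open>Found by integration by parts. The product \<open>x * ln x\<close> is kept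
    together so that its limit 0 settles the endpoint 0 even for \<open>m = 0\<close>.\<close>
  let ?F = "\<lambda>x::real. x ^ Suc m / (real m + 1)\<^sup>2 - x ^ m * (x * ln x) / (real m + 1)"
  have "((\<lambda>x::real. - (x ^ m * ln x)) has_integral (1 / (real m + 1)\<^sup>2 - 0)) {0<..<1}"
  proof (rule has_integral_FTC_nonneg_Ioo[where F = ?F])
    fix x :: real assume x: "0 < x" "x < 1"
    have "((\<lambda>x. x ^ Suc m) has_real_derivative (real m + 1) * x ^ m) (at x)"
      using DERIV_pow[of "Suc m" x] by (simp add: add.commute)
    from DERIV_diff[OF DERIV_cdivide[OF this] DERIV_cdivide[OF DERIV_mult[OF this DERIV_ln_divide[OF x(1)]]]]
    have "((\<lambda>x. x ^ Suc m / (real m + 1)\<^sup>2 - x ^ Suc m * ln x / (real m + 1)) has_real_derivative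
        - (x ^ m * ln x)) (at x)"
      by (rule DERIV_cong) (use x in \<open>simp add: divide_simps power2_eq_square\<close>; simp add: algebra_simps)
    then show "(?F has_real_derivative - (x ^ m * ln x)) (at x)"
      by (simp add: mult_ac)
    show "isCont (\<lambda>x. - (x ^ m * ln x)) x"
      using x by (intro continuous_intros) auto
    show "0 \<le> - (x ^ m * ln x)"
      using x by (simp add: mult_nonneg_nonpos)
  next
    have "((\<lambda>x::real. x * ln x) \<longlongrightarrow> 0) (at_right 0)"
      by real_asymp
    then have "(?F \<longlongrightarrow> 0 ^ Suc m / (real m + 1)\<^sup>2 - 0 ^ m * 0 / (real m + 1)) (at_right 0)"
      by (intro tendsto_intros) auto
    then show "(?F \<longlongrightarrow> 0) (at_right 0)" by simp
    have "(?F \<longlongrightarrow> 1 ^ Suc m / (real m + 1)\<^sup>2 - 1 ^ m * (1 * ln 1) / (real m + 1)) (at_left 1)"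
      by (intro tendsto_intros) auto
    then show "(?F \<longlongrightarrow> 1 / (real m + 1)\<^sup>2) (at_left 1)" by simp
  qed simp
  then show ?thesis by simp
qed

text \<open>Beyond 1 the logarithm is nonnegative and \<open>x + a > 1\<close>, so the quotient with
  exponent 1 dominates all higher exponents.\<close>

lemma tendsto_ln_over_power_at_top:
  fixes a :: real
  assumes "a > 0"
  shows "((\<lambda>x. ln x / (x + a) ^ Suc n) \<longlongrightarrow> 0) at_top"
proof (rule Lim_null_comparison)
  show "((\<lambda>x. ln x / (x + a)) \<longlongrightarrow> 0) at_top"
    by real_asymp
  show "\<forall>\<^sub>F x in at_top. norm (ln x / (x + a) ^ Suc n) \<le> ln x / (x + a)"
    using eventually_ge_at_top[of 1]
  proof eventually_elim
    case (elim x)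
    have "ln x / (x + a) ^ Suc n \<le> ln x / (x + a) ^ 1"
      using elim assms by (intro divide_left_mono power_increasing mult_pos_pos) auto
    then show ?case using elim assms by simp
  qed
qed

lemma DERIV_inverse_shifted_power:
  fixes a x :: real
  assumes "x + a \<noteq> 0"
  shows "((\<lambda>x. 1 / (x + a) ^ Suc k) has_real_derivative - (real k + 1) / (x + a) ^ (k + 2)) (at x)"
proof -
  have "((\<lambda>x. (x + a) ^ Suc k) has_real_derivative (real k + 1) * (x + a) ^ k) (at x)"
    using DERIV_power[OF DERIV_add[OF DERIV_ident DERIV_const[of a]], of "Suc k" x]
    by (simp add: add.commute)
  from DERIV_divide[OF DERIV_const[of 1] this]
  have "((\<lambda>x. 1 / (x + a) ^ Suc k) has_real_derivative
      (0 * (x + a) ^ Suc k - 1 * ((real k + 1) * (x + a) ^ k)) / ((x + a) ^ Suc k * (x + a) ^ Suc k)) (at x)"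
    using assms by simp
  then show ?thesis
    by (rule DERIV_cong) (use assms in \<open>simp add: divide_simps\<close>)
qed

text \<open>Prepares integration by parts: the second term is a multiple of the integrand of
  interest, and the first is integrated by partial fractions when \<open>a > 0\<close>. Allowing
  \<open>a = 0\<close> covers plain powers of \<open>x\<close>.\<close>

lemma DERIV_ln_over_shifted_power:
  fixes a x :: real
  assumes "x > 0" and "a \<ge> 0"
  shows "((\<lambda>x. ln x / (x + a) ^ Suc k) has_real_derivative
           1 / (x * (x + a) ^ Suc k) - (real k + 1) * (ln x / (x + a) ^ (k + 2))) (at x)"
proof -
  have "((\<lambda>x. ln x * (1 / (x + a) ^ Suc k)) has_real_derivative
      1 / x * (1 / (x + a) ^ Suc k) + - (real k + 1) / (x + a) ^ (k + 2) * ln x) (at x)"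
    using assms by (intro DERIV_mult DERIV_ln_divide DERIV_inverse_shifted_power) auto
  moreover have "1 / x * (1 / p) + - r / q * ln x = 1 / (x * p) - r * (ln x / q)" for p q r
    by simp
  ultimately show ?thesis
    by (simp only: times_divide_eq_right mult_1_right)
qed

text \<open>Substituting \<open>1 / x\<close> for \<open>x\<close> turns
  \<open>- (x ^ m * ln x)\<close> on \<open>{0<..<1}\<close> into this integrand, whence the same
  value; the proof uses an antiderivative directly.\<close>

lemma has_integral_ln_over_power_1_inf:
  "((\<lambda>x::real. ln x / x ^ (m + 2)) has_integral (1 / (real m + 1)\<^sup>2)) {1<..}"
proof -
  let ?F = "\<lambda>x::real. - (ln x / x ^ Suc m) / (real m + 1) - 1 / x ^ Suc m / (real m + 1)\<^sup>2"
  have "((\<lambda>x::real. ln x / x ^ (m + 2)) has_integral (0 - (- 1 / (real m + 1)\<^sup>2))) {1<..}"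
  proof (rule has_integral_FTC_nonneg_Ioi[where F = ?F])
    fix x :: real assume x: "1 < x"
    have d1: "((\<lambda>x. ln x / x ^ Suc m) has_real_derivative
        1 / (x * x ^ Suc m) - (real m + 1) * (ln x / x ^ (m + 2))) (at x)"
      using DERIV_ln_over_shifted_power[of x 0 m] x by simp
    have d2: "((\<lambda>x. 1 / x ^ Suc m) has_real_derivative - (real m + 1) / x ^ (m + 2)) (at x)"
      using DERIV_inverse_shifted_power[of x 0 m] x by simp
    show "(?F has_real_derivative ln x / x ^ (m + 2)) (at x)"
      by (rule DERIV_cong[OF DERIV_diff[OF DERIV_cdivide[OF DERIV_minus[OF d1]] DERIV_cdivide[OF d2]]])
         (use x in \<open>simp add: divide_simps power2_eq_square\<close>; simp add: algebra_simps)
    show "isCont (\<lambda>x. ln x / x ^ (m + 2)) x"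
      using x by (intro continuous_intros) auto
    show "0 \<le> ln x / x ^ (m + 2)"
      using x by simp
  next
    have "(?F \<longlongrightarrow> - (ln 1 / 1 ^ Suc m) / (real m + 1) - 1 / 1 ^ Suc m / (real m + 1)\<^sup>2) (at_right 1)"
      by (intro tendsto_intros) auto
    then show "(?F \<longlongrightarrow> - 1 / (real m + 1)\<^sup>2) (at_right 1)" by simp
    have "((\<lambda>x::real. ln x / x ^ Suc m) \<longlongrightarrow> 0) at_top"
      by real_asymp
    moreover have "((\<lambda>x::real. 1 / x ^ Suc m) \<longlongrightarrow> 0) at_top"
      by real_asymp
    ultimately have "(?F \<longlongrightarrow> - 0 / (real m + 1) - 0 / (real m + 1)\<^sup>2) at_top"
      by (intro tendsto_intros) auto
    then show "(?F \<longlongrightarrow> 0) at_top" by simp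
  qed
  then show ?thesis by simp
qed

section \<open>The value at \<open>a = 1\<close>\<close>

text \<open>The even squares contribute a quarter of the full sum \<open>pi\<^sup>2 / 6\<close>, so
  three quarters remain.\<close>

lemma inverse_odd_squares_sums: "(\<lambda>n. 1 / (2 * real n + 1)\<^sup>2) sums (pi\<^sup>2 / 8)"
proof -
  have all: "(\<lambda>n. 1 / (real n + 1)\<^sup>2) sums (pi\<^sup>2 / 6)"
    using inverse_squares_sums by (simp add: add.commute)
  have "(\<lambda>n. \<Sum>i = n * 2..<n * 2 + 2. 1 / (real i + 1)\<^sup>2) sums (pi\<^sup>2 / 6)"
    by (rule sums_group[OF all]) simp
  then have "(\<lambda>n. 1 / (2 * real n + 1)\<^sup>2 + 1 / (2 * real n + 2)\<^sup>2) sums (pi\<^sup>2 / 6)"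
    by (simp add: numeral_2_eq_2 algebra_simps)
  moreover have "(\<lambda>n. 1 / (2 * real n + 2)\<^sup>2) sums (pi\<^sup>2 / 6 / 4)"
    using sums_divide[OF all, of 4] by (simp add: power2_eq_square algebra_simps)
  ultimately have "(\<lambda>n. 1 / (2 * real n + 1)\<^sup>2) sums (pi\<^sup>2 / 6 - pi\<^sup>2 / 6 / 4)"
    using sums_diff by fastforce
  then show ?thesis by simp
qed

text \<open>Partial sums of nonnegative terms increase, so monotone convergence permits integrating
  the series term by term.\<close>

lemma has_integral_sums_nonneg:
  fixes f :: "nat \<Rightarrow> real \<Rightarrow> real"
  assumes int: "\<And>n. (f n has_integral c n) S"
    and nonneg: "\<And>n x. x \<in> S \<Longrightarrow> 0 \<le> f n x"
    and g: "\<And>x. x \<in> S \<Longrightarrow> (\<lambda>n. f n x) sums g x" and "c sums s"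
  shows "(g has_integral s) S"
proof (rule has_integral_monotone_convergence_increasing)
  show "((\<lambda>x. \<Sum>n<k. f n x) has_integral (\<Sum>n<k. c n)) S" for k
    by (intro has_integral_sum int) auto
qed (use nonneg g \<open>c sums s\<close> in \<open>auto simp: sums_def\<close>)

text \<open>The geometric series in \<open>x\<^sup>2\<close> and in \<open>1 / x\<^sup>2\<close>
  contain only even exponents, so only odd squares arise; each side of 1 contributes
  \<open>pi\<^sup>2 / 8\<close>.\<close>

lemma has_integral_ln_over_square_minus_1:
  "((\<lambda>x::real. ln x / ((x - 1) * (x + 1))) has_integral (pi\<^sup>2 / 4)) {0<..}"
proof -
  have "((\<lambda>x::real. ln x / ((x - 1) * (x + 1))) has_integral (pi\<^sup>2 / 8)) {0<..<1}"
  proof (rule has_integral_sums_nonneg[OF _ _ _ inverse_odd_squares_sums])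
    show "((\<lambda>x::real. - (x ^ (2 * n) * ln x)) has_integral (1 / (2 * real n + 1)\<^sup>2)) {0<..<1}" for n
      using has_integral_power_mult_ln_01[of "2 * n"] by simp
    fix x :: real assume x: "x \<in> {0<..<1}"
    show "0 \<le> - (x ^ (2 * n) * ln x)" for n
      using x by (simp add: mult_nonneg_nonpos)
    have "(\<lambda>n. (x\<^sup>2) ^ n) sums (1 / (1 - x\<^sup>2))"
      using x by (intro geometric_sums) (auto simp: power_less_one_iff abs_square_less_1)
    then have "(\<lambda>n. (x\<^sup>2) ^ n * - ln x) sums (1 / (1 - x\<^sup>2) * - ln x)"
      by (rule sums_mult2)
    moreover have "1 / (1 - x\<^sup>2) * - ln x = ln x / ((x - 1) * (x + 1))"
      using minus_divide_divide[of "ln x" "1 - x\<^sup>2"] by (simp add: power2_eq_square algebra_simps)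
    ultimately show "(\<lambda>n. - (x ^ (2 * n) * ln x)) sums (ln x / ((x - 1) * (x + 1)))"
      by (simp add: power_mult)
  qed
  moreover have "((\<lambda>x::real. ln x / ((x - 1) * (x + 1))) has_integral (pi\<^sup>2 / 8)) {1<..}"
  proof (rule has_integral_sums_nonneg[OF _ _ _ inverse_odd_squares_sums])
    show "((\<lambda>x::real. ln x / x ^ (2 * n + 2)) has_integral (1 / (2 * real n + 1)\<^sup>2)) {1<..}" for n
      using has_integral_ln_over_power_1_inf[of "2 * n"] by simp
    fix x :: real assume x: "x \<in> {1<..}"
    then have x2: "x\<^sup>2 > 1" by (simp add: one_less_power)
    show "0 \<le> ln x / x ^ (2 * n + 2)" for n
      using x by simp
    \<comment> \<open>For \<open>x > 1\<close>, the series expands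
      \<open>1 / (x\<^sup>2 - 1) = (1 / x\<^sup>2) / (1 - 1 / x\<^sup>2)\<close>.\<close>
    have "(\<lambda>n. (1 / x\<^sup>2) ^ n) sums (1 / (1 - 1 / x\<^sup>2))"
      using x x2 by (intro geometric_sums) auto
    then have "(\<lambda>n. (1 / x\<^sup>2) ^ n * (ln x / x\<^sup>2)) sums (1 / (1 - 1 / x\<^sup>2) * (ln x / x\<^sup>2))"
      by (rule sums_mult2)
    moreover have "1 / (1 - 1 / x\<^sup>2) * (ln x / x\<^sup>2) = ln x / ((x - 1) * (x + 1))"
      using x x2 by (simp add: field_simps power2_eq_square)
    moreover have "(\<lambda>n. (1 / x\<^sup>2) ^ n * (ln x / x\<^sup>2)) = (\<lambda>n. ln x / x ^ (2 * n + 2))"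
      by (simp add: power_one_over power_mult power_add power2_eq_square power_mult_distrib mult_ac)
    ultimately show "(\<lambda>n. ln x / x ^ (2 * n + 2)) sums (ln x / ((x - 1) * (x + 1)))"
      by metis
  qed
  ultimately show ?thesis
    using has_integral_Ioi_split[of _ "pi\<^sup>2 / 8" 0 1 "pi\<^sup>2 / 8"] by simp
qed


section \<open>The elementary integral of \<open>ln x / (x + a) ^ (k + 2)\<close>\<close>

text \<open>Besides its derivative, only the behaviour of \<open>P\<close> at 0 and at infinity
  enters later, so \<open>P\<close> stays implicit. Once its logarithmic divergence at 0 is
  subtracted, the constant left over is the source of the harmonic numbers.\<close>

lemma antiderivative_inverse_mult_power:
  fixes a :: real
  assumes "a > 0"
  obtains P where "\<And>x. x > 0 \<Longrightarrow> (P has_real_derivative 1 / (x * (x + a) ^ Suc k)) (at x)"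
    and "((\<lambda>x. P x - ln x / a ^ Suc k) \<longlongrightarrow> (harm k - ln a) / a ^ Suc k) (at_right 0)"
    and "(P \<longlongrightarrow> 0) at_top"
proof (induction k arbitrary: thesis)
  case 0
  show ?case
  proof (rule 0)
    let ?P = "\<lambda>x. (ln x - ln (x + a)) / a"
    show "(?P has_real_derivative 1 / (x * (x + a) ^ Suc 0)) (at x)" if "x > 0" for x
      using that assms
      by (auto intro!: derivative_eq_intros simp: divide_simps)
    have "((\<lambda>x. - ln (x + a) / a) \<longlongrightarrow> - ln (0 + a) / a) (at_right 0)"
      using assms by (intro tendsto_intros) auto
    then show "((\<lambda>x. ?P x - ln x / a ^ Suc 0) \<longlongrightarrow> (harm 0 - ln a) / a ^ Suc 0) (at_right 0)"
      by (simp add: diff_divide_distrib harm_def)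
    show "(?P \<longlongrightarrow> 0) at_top"
      using assms by real_asymp
  qed
next
  case (Suc k)
  obtain P where P: "\<And>x. x > 0 \<Longrightarrow> (P has_real_derivative 1 / (x * (x + a) ^ Suc k)) (at x)"
    and P0: "((\<lambda>x. P x - ln x / a ^ Suc k) \<longlongrightarrow> (harm k - ln a) / a ^ Suc k) (at_right 0)"
    and Pinf: "(P \<longlongrightarrow> 0) at_top"
    using Suc.IH by blast
  \<comment> \<open>The recursion rests on
    \<open>1 / (x * (x + a)) = (1 / x - 1 / (x + a)) / a\<close>. \<open>?R\<close> integrates
    \<open>- 1 / (x + a) ^ (k + 2)\<close>; its value at 0 supplies, up to a power of
    \<open>a\<close>, the next harmonic summand.\<close>
  let ?R = "\<lambda>x. 1 / (x + a) ^ Suc k / (real k + 1)"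
  let ?P = "\<lambda>x. (P x + ?R x) / a"
  show ?case
  proof (rule Suc.prems)
    fix x :: real assume "x > 0"
    have "(?R has_real_derivative - (real k + 1) / (x + a) ^ (k + 2) / (real k + 1)) (at x)"
      using \<open>x > 0\<close> assms by (intro DERIV_cdivide DERIV_inverse_shifted_power) auto
    from DERIV_cdivide[OF DERIV_add[OF P[OF \<open>x > 0\<close>] this], of a]
    show "(?P has_real_derivative 1 / (x * (x + a) ^ Suc (Suc k))) (at x)"
      by (rule DERIV_cong) (use \<open>x > 0\<close> assms in \<open>simp add: divide_simps; simp add: algebra_simps\<close>)
  next
    have "((\<lambda>x. (P x - ln x / a ^ Suc k + ?R x) / a) \<longlongrightarrow>
        ((harm k - ln a) / a ^ Suc k + 1 / (0 + a) ^ Suc k / (real k + 1)) / a) (at_right 0)"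
      using assms by (intro tendsto_intros P0) auto
    moreover have "(P x - ln x / a ^ Suc k + ?R x) / a = ?P x - ln x / a ^ Suc (Suc k)" for x
      by (simp add: add_divide_distrib diff_divide_distrib mult.commute)
    moreover have "((harm k - ln a) / a ^ Suc k + 1 / (0 + a) ^ Suc k / (real k + 1)) / a
        = (harm (Suc k) - ln a) / a ^ Suc (Suc k)"
      using assms by (simp add: harm_Suc add_divide_distrib diff_divide_distrib inverse_eq_divide mult_ac add_ac)
    ultimately show "((\<lambda>x. ?P x - ln x / a ^ Suc (Suc k)) \<longlongrightarrow>
        (harm (Suc k) - ln a) / a ^ Suc (Suc k)) (at_right 0)"
      by simp
    have "((\<lambda>x. 1 / (x + a) ^ Suc k) \<longlongrightarrow> 0) at_top"
      by real_asymp
    then have "(?P \<longlongrightarrow> (0 + 0 / (real k + 1)) / a) at_top"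
      using assms by (intro tendsto_intros Pinf) auto
    then show "(?P \<longlongrightarrow> 0) at_top" by simp
  qed
qed

text \<open>Write \<open>ln x * g x\<close> as \<open>(x * ln x) * (g x / x)\<close>: the first
  factor tends to 0 and the second to \<open>D\<close>.\<close>

lemma tendsto_ln_mult_at_right_0:
  fixes g :: "real \<Rightarrow> real"
  assumes "(g has_real_derivative D) (at 0)" and "g 0 = 0"
  shows "((\<lambda>x. ln x * g x) \<longlongrightarrow> 0) (at_right 0)"
proof -
  have "((\<lambda>x. g x / x) \<longlongrightarrow> D) (at_right 0)"
    using assms by (auto simp: DERIV_def intro: filterlim_mono[OF _ order_refl at_le])
  moreover have "((\<lambda>x::real. x * ln x) \<longlongrightarrow> 0) (at_right 0)"
    by real_asymp
  ultimately have "((\<lambda>x. x * ln x * (g x / x)) \<longlongrightarrow> 0 * D) (at_right 0)"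
    by (intro tendsto_mult)
  moreover have "\<forall>\<^sub>F x in at_right 0. x * ln x * (g x / x) = ln x * g x"
    by (auto simp: eventually_at_filter)
  ultimately show ?thesis
    using Lim_transform_eventually by fastforce
qed

lemma has_integral_ln_over_shifted_power:
  fixes a :: real
  assumes "a > 0"
  shows "((\<lambda>x. ln x / (x + a) ^ (k + 2)) has_integral
           (- ((harm k - ln a) / (a ^ Suc k * (real k + 1))))) {0<..}"
proof -
  obtain P where P: "\<And>x. x > 0 \<Longrightarrow> (P has_real_derivative 1 / (x * (x + a) ^ Suc k)) (at x)"
    and P0: "((\<lambda>x. P x - ln x / a ^ Suc k) \<longlongrightarrow> (harm k - ln a) / a ^ Suc k) (at_right 0)"
    and Pinf: "(P \<longlongrightarrow> 0) at_top"
    using antiderivative_inverse_mult_power[OF assms] by blast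
  \<comment> \<open>integration by parts\<close>
  let ?F = "\<lambda>x. (P x - ln x / (x + a) ^ Suc k) / (real k + 1)"
  have "((\<lambda>x. ln x / (x + a) ^ (k + 2)) has_integral
          (0 - (harm k - ln a) / a ^ Suc k / (real k + 1))) {0<..}"
  proof (rule has_integral_FTC_sign_change_Ioi[where F = ?F and b = 1])
    fix x :: real assume x: "0 < x"
    have "((\<lambda>x. ln x / (x + a) ^ Suc k) has_real_derivative
        1 / (x * (x + a) ^ Suc k) - (real k + 1) * (ln x / (x + a) ^ (k + 2))) (at x)"
      using x assms by (intro DERIV_ln_over_shifted_power) auto
    from DERIV_cdivide[OF DERIV_diff[OF P[OF x] this], of "real k + 1"]
    show "(?F has_real_derivative ln x / (x + a) ^ (k + 2)) (at x)"
      by (rule DERIV_cong) simp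
    show "isCont (\<lambda>x. ln x / (x + a) ^ (k + 2)) x"
      using x assms by (intro continuous_intros) auto
    show "ln x / (x + a) ^ (k + 2) \<le> 0" if "x < 1"
      using x that assms by (intro divide_nonpos_pos) auto
  next
    show "0 \<le> ln x / (x + a) ^ (k + 2)" if "1 < x" for x
      using that assms by simp
  next
    \<comment> \<open>Both parts of \<open>?F\<close> diverge like \<open>ln x / a ^ Suc k\<close>
      at 0. Since \<open>?g\<close> vanishes there, replacing \<open>x + a\<close> by
      \<open>a\<close> in the logarithmic term costs only \<open>ln x * ?g x\<close>, which tends to
      0.\<close>
    let ?g = "\<lambda>x. 1 / a ^ Suc k - 1 / (x + a) ^ Suc k"
    have "(?g has_real_derivative 0 - - (real k + 1) / (0 + a) ^ (k + 2)) (at 0)"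
      using assms by (intro DERIV_diff DERIV_const DERIV_inverse_shifted_power) auto
    then have "((\<lambda>x. ln x * ?g x) \<longlongrightarrow> 0) (at_right 0)"
      using tendsto_ln_mult_at_right_0[of ?g] by auto
    then have "((\<lambda>x. (P x - ln x / a ^ Suc k + ln x * ?g x) / (real k + 1)) \<longlongrightarrow>
        ((harm k - ln a) / a ^ Suc k + 0) / (real k + 1)) (at_right 0)"
      by (intro tendsto_intros P0) auto
    then show "(?F \<longlongrightarrow> (harm k - ln a) / a ^ Suc k / (real k + 1)) (at_right 0)"
      by (simp add: right_diff_distrib)
    have "(?F \<longlongrightarrow> (0 - 0) / (real k + 1)) at_top"
      by (intro tendsto_intros Pinf tendsto_ln_over_power_at_top assms) auto
    then show "(?F \<longlongrightarrow> 0) at_top" by simp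
  qed simp
  then show ?thesis by simp
qed

section \<open>Integrability and the recursion in \<open>k\<close>\<close>

text \<open>Numerator and denominator change sign together at 1, where the quotient is
  \<open>0 / 0 = 0\<close>. The main integrands thus have one sign and can be compared.\<close>

lemma ln_over_minus_1_nonneg: "x > 0 \<Longrightarrow> 0 \<le> ln x / (x - 1)" for x :: real
  by (cases "x \<ge> 1") (auto intro: divide_nonpos_neg)

text \<open>Comparison with the case \<open>a = 1\<close> up to a constant:
  \<open>x + a \<ge> x + 1\<close> if \<open>a \<ge> 1\<close>, and
  \<open>x + a \<ge> a * (x + 1)\<close> otherwise.\<close>

lemma integrable_ln_over_minus_1_mult:
  fixes a :: real
  assumes "a > 0"
  shows "(\<lambda>x. ln x / ((x - 1) * (x + a))) integrable_on {0<..}"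
proof (rule measurable_bounded_by_integrable_imp_integrable)
  show "(\<lambda>x. ln x / ((x - 1) * (x + a))) \<in> borel_measurable (lebesgue_on {0<..})"
    by (intro measurable_restrict_space1 measurable_completion) measurable
  show "(\<lambda>x. max 1 (1 / a) * (ln x / ((x - 1) * (x + 1)))) integrable_on {0<..}"
    using has_integral_mult_right[OF has_integral_ln_over_square_minus_1] by (auto simp: integrable_on_def)
  fix x :: real assume "x \<in> {0<..}"
  then have x: "x > 0" by simp
  have "1 / (x + a) \<le> max 1 (1 / a) * (1 / (x + 1))"
  proof (cases "a \<ge> 1")
    case True
    then show ?thesis using x assms by (simp add: field_simps max_def)
  next
    case False
    then have "max 1 (1 / a) = 1 / a" using assms by simp
    moreover have "a * (x + 1) \<le> x + a" using False x by (simp add: algebra_simps mult_left_le_one_le)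
    ultimately show ?thesis using x assms by (simp add: frac_le)
  qed
  from mult_left_mono[OF this ln_over_minus_1_nonneg[OF x]]
  have "ln x / ((x - 1) * (x + a)) \<le> max 1 (1 / a) * (ln x / ((x - 1) * (x + 1)))"
    by (simp add: mult_ac)
  moreover have "0 \<le> ln x / ((x - 1) * (x + a))"
    using divide_nonneg_nonneg[OF ln_over_minus_1_nonneg[OF x], of "x + a"] x assms by simp
  ultimately show "norm (ln x / ((x - 1) * (x + a))) \<le> max 1 (1 / a) * (ln x / ((x - 1) * (x + 1)))"
    by (simp only: real_norm_def abs_of_nonneg)
qed simp

text \<open>One step of the partial fraction recursion, with the point 1 set aside in order to clear
  the factor \<open>x - 1\<close>. The plus sign arises because the subtracted elementary integral
  carries a minus sign.\<close>

lemma has_integral_ln_over_minus_1_mult_power_Suc: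
  fixes a :: real
  assumes "a > 0" and "((\<lambda>x. ln x / ((x - 1) * (x + a) ^ (k + 1))) has_integral I) {0<..}"
  shows "((\<lambda>x. ln x / ((x - 1) * (x + a) ^ (k + 2))) has_integral
           ((I + (harm k - ln a) / (a ^ Suc k * (real k + 1))) / (a + 1))) {0<..}"
proof (rule has_integral_spike_finite)
  show "((\<lambda>x. (ln x / ((x - 1) * (x + a) ^ (k + 1)) - ln x / (x + a) ^ (k + 2)) / (a + 1)) has_integral
           ((I + (harm k - ln a) / (a ^ Suc k * (real k + 1))) / (a + 1))) {0<..}"
    using has_integral_divide[OF has_integral_diff[OF assms(2) has_integral_ln_over_shifted_power[OF assms(1)]]]
    by simp
  fix x assume "x \<in> {0<..} - {1::real}"
  then show "ln x / ((x - 1) * (x + a) ^ (k + 2))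
      = (ln x / ((x - 1) * (x + a) ^ (k + 1)) - ln x / (x + a) ^ (k + 2)) / (a + 1)"
    using assms by (simp add: divide_simps) (simp add: algebra_simps)
qed simp

section \<open>The case \<open>k = 0\<close> by differentiation in \<open>a\<close>\<close>

text \<open>Differentiation under the integral by a direct estimate: the first-order remainder in
  the parameter is the integral of an explicit nonnegative function, bounded by
  \<open>(b - a)\<^sup>2\<close> times a fixed integrable one.\<close>

lemma deriv_integral_ln_over_minus_1_mult:
  fixes a :: real
  assumes "a > 0"
  defines "I \<equiv> \<lambda>a::real. integral {0<..} (\<lambda>x. ln x / ((x - 1) * (x + a)))"
  shows "(I has_real_derivative - ((I a - ln a / a) / (a + 1))) (at a)"
proof -
  have I0: "((\<lambda>x. ln x / ((x - 1) * (x + b))) has_integral I b) {0<..}" if "b > 0" for b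
    unfolding I_def using integrable_ln_over_minus_1_mult[OF that] by (rule integrable_integral)
  have I1: "((\<lambda>x. ln x / ((x - 1) * (x + b)\<^sup>2)) has_integral ((I b - ln b / b) / (b + 1))) {0<..}"
    if "b > 0" for b
    using has_integral_ln_over_minus_1_mult_power_Suc[OF that, of 0 "I b"] I0[OF that]
    by (simp add: harm_def numeral_2_eq_2)
  \<comment> \<open>Two steps of the recursion at \<open>a / 2\<close> make the kernel with a third
    power integrable. It dominates the remainders uniformly for \<open>b > a / 2\<close>, where both
    \<open>x + a\<close> and \<open>x + b\<close> exceed \<open>x + a / 2\<close>.\<close>
  have "((\<lambda>x. ln x / ((x - 1) * (x + a / 2) ^ (1 + 1))) has_integral
      ((I (a / 2) - ln (a / 2) / (a / 2)) / (a / 2 + 1))) {0<..}"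
    using I1[of "a / 2"] assms(1) by (simp only: one_add_one half_gt_zero)
  from has_integral_ln_over_minus_1_mult_power_Suc[OF _ this] assms(1)
  obtain C where "((\<lambda>x. ln x / ((x - 1) * (x + a / 2) ^ (1 + 2))) has_integral C) {0<..}"
    by (meson half_gt_zero)
  then have C: "((\<lambda>x. ln x / ((x - 1) * (x + a / 2) ^ 3)) has_integral C) {0<..}"
    by (simp add: power3_eq_cube mult.assoc)
  \<comment> \<open>By \<open>I1\<close>, \<open>D\<close> is the integral with the squared factor,
    so \<open>- D\<close> is the expected derivative.\<close>
  define D where "D = (I a - ln a / a) / (a + 1)"
  have bound: "\<bar>I b - I a + (b - a) * D\<bar> \<le> (b - a)\<^sup>2 * C" if b: "b > a / 2" for b
  proof -
    define r where "r x = ln x / ((x - 1) * (x + b)) - ln x / ((x - 1) * (x + a))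
        + (b - a) * (ln x / ((x - 1) * (x + a)\<^sup>2))" for x
    have r: "(r has_integral (I b - I a + (b - a) * D)) {0<..}"
      unfolding r_def D_def using assms(1) b
      by (intro has_integral_add has_integral_diff has_integral_mult_right I0 I1) auto
    have r_eq: "r x = (b - a)\<^sup>2 * (ln x / (x - 1) * (1 / ((x + a)\<^sup>2 * (x + b))))" if "x > 0" for x
    proof -
      \<comment> \<open>Exact remainder of the tangent at \<open>b = a\<close> to
        \<open>1 / (x + b)\<close> as a function of \<open>b\<close>.\<close>
      have "1 / (x + b) - 1 / (x + a) + (b - a) * (1 / (x + a)\<^sup>2) = (b - a)\<^sup>2 * (1 / ((x + a)\<^sup>2 * (x + b)))"
        using that assms(1) b by (simp add: divide_simps) (simp add: power2_eq_square algebra_simps)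
      from arg_cong[OF this, of "\<lambda>t. ln x / (x - 1) * t"] show ?thesis
        by (simp add: r_def ring_distribs mult_ac)
    qed
    have r_nonneg: "0 \<le> r x" if "x > 0" for x
      unfolding r_eq[OF that] using that assms(1) b ln_over_minus_1_nonneg[OF that]
      by (intro mult_nonneg_nonneg) auto
    have r_le: "r x \<le> (b - a)\<^sup>2 * (ln x / ((x - 1) * (x + a / 2) ^ 3))" if "x > 0" for x
    proof -
      have "(x + a / 2)\<^sup>2 * (x + a / 2) \<le> (x + a)\<^sup>2 * (x + b)"
        using that assms(1) b by (intro mult_mono power_mono) auto
      then have "1 / ((x + a)\<^sup>2 * (x + b)) \<le> 1 / (x + a / 2) ^ 3"
        using that assms(1) b by (intro divide_left_mono mult_pos_pos) (auto simp: power3_eq_cube power2_eq_square)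
      then have "r x \<le> (b - a)\<^sup>2 * (ln x / (x - 1) * (1 / (x + a / 2) ^ 3))"
        unfolding r_eq[OF that] using ln_over_minus_1_nonneg[OF that]
        by (intro mult_left_mono) auto
      then show ?thesis by simp
    qed
    have "0 \<le> I b - I a + (b - a) * D"
      by (rule has_integral_nonneg[OF r]) (use r_nonneg in auto)
    moreover have "I b - I a + (b - a) * D \<le> (b - a)\<^sup>2 * C"
      by (rule has_integral_le[OF r has_integral_mult_right[OF C]]) (use r_le in auto)
    ultimately show ?thesis by simp
  qed
  have "((\<lambda>b. (I b - I a) / (b - a) - - D) \<longlongrightarrow> 0) (at a)"
  proof (rule Lim_null_comparison)
    show "\<forall>\<^sub>F b in at a. norm ((I b - I a) / (b - a) - - D) \<le> \<bar>b - a\<bar> * C"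
      using eventually_at_in_open[of "{a / 2<..}" a]
    proof (rule eventually_mono)
      fix b assume "b \<in> {a / 2<..} - {a}"
      then have b: "b > a / 2" "b \<noteq> a" by auto
      have "(I b - I a) / (b - a) - - D = (I b - I a + (b - a) * D) / (b - a)"
        using b by (simp add: field_simps)
      then have "norm ((I b - I a) / (b - a) - - D) \<le> (b - a)\<^sup>2 * C / \<bar>b - a\<bar>"
        using divide_right_mono[OF bound[OF b(1)], of "\<bar>b - a\<bar>"] by simp
      also have "\<dots> = \<bar>b - a\<bar> * C"
        using b by (simp add: power2_eq_square abs_if field_simps)
      finally show "norm ((I b - I a) / (b - a) - - D) \<le> \<bar>b - a\<bar> * C" .
    qed (use assms(1) in auto)
    have "((\<lambda>b. \<bar>b - a\<bar> * C) \<longlongrightarrow> \<bar>a - a\<bar> * C) (at a)"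
      by (intro tendsto_intros)
    then show "((\<lambda>b. \<bar>b - a\<bar> * C) \<longlongrightarrow> 0) (at a)" by simp
  qed
  then show ?thesis
    unfolding has_field_derivative_iff D_def[symmetric] by (rule LIM_zero_cancel)
qed


lemma has_integral_ln_over_minus_1_mult:
  fixes a :: real
  assumes "a > 0"
  shows "((\<lambda>x. ln x / ((x - 1) * (x + a))) has_integral ((pi\<^sup>2 + (ln a)\<^sup>2) / 2 / (a + 1))) {0<..}"
proof -
  define I where "I a = integral {0<..} (\<lambda>x. ln x / ((x - 1) * (x + a)))" for a :: real
  define J where "J a = (a + 1) * I a - (ln a)\<^sup>2 / 2" for a
  have I': "(I has_real_derivative - ((I b - ln b / b) / (b + 1))) (at b)" if "b > 0" for b
    using deriv_integral_ln_over_minus_1_mult[OF that] unfolding I_def .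
  \<comment> \<open>The derivative of \<open>(b + 1) * I b\<close> is
    \<open>I b - (I b - ln b / b) = ln b / b\<close>, which is also that of
    \<open>(ln b)\<^sup>2 / 2\<close>.\<close>
  have "(J has_real_derivative 0) (at b within {0<..})" if "b \<in> {0<..}" for b
    unfolding J_def using that
    by (auto intro!: derivative_eq_intros I'[THEN DERIV_subset] simp: divide_simps)
  then obtain c where c: "\<And>b. b > 0 \<Longrightarrow> J b = c"
    using has_field_derivative_zero_constant[of "{0<..}" J] by auto
  have "I 1 = pi\<^sup>2 / 4"
    unfolding I_def using has_integral_ln_over_square_minus_1 by (rule integral_unique)
  \<comment> \<open>As \<open>ln 1 = 0\<close>, the constant is
    \<open>J 1 = 2 * I 1\<close>.\<close>
  then have "J a = pi\<^sup>2 / 2"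
    using c[OF assms] c[of 1] by (simp add: J_def)
  then have "I a = (pi\<^sup>2 + (ln a)\<^sup>2) / 2 / (a + 1)"
    using assms by (simp add: J_def field_simps)
  then show ?thesis
    using integrable_integral[OF integrable_ln_over_minus_1_mult[OF assms]] by (simp add: I_def)
qed

theorem theorem2:
  fixes k :: nat and a :: real
  assumes "a > 0"
  shows "((\<lambda>x::real. ln x / ((x - 1) * (x + a) ^ (k + 1))) has_integral
           (1 / (a + 1) ^ (k + 1) *
             ((pi\<^sup>2 + (ln a)\<^sup>2) / 2 +
              (\<Sum>j<k. (1 + 1 / a) ^ (j + 1) / (real j + 1) * (harm j - ln a))))) {0<..}"
proof (induction k)
  case 0
  show ?case
    using has_integral_ln_over_minus_1_mult[OF assms] by (simp add: mult.commute)
next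
  case (Suc k)
  define S where "S = (pi\<^sup>2 + (ln a)\<^sup>2) / 2 + (\<Sum>j<k. (1 + 1 / a) ^ (j + 1) / (real j + 1) * (harm j - ln a))"
  define t where "t = harm k - ln a"
  \<comment> \<open>The recursion contributes a term with \<open>1 / a ^ Suc k\<close>; pulling
    \<open>1 / (a + 1) ^ (k + 2)\<close> out of it leaves \<open>((a + 1) / a) ^ (k + 1)\<close>,
    the power in the new summand.\<close>
  have "(1 + 1 / a) ^ (k + 1) = (a + 1) ^ (k + 1) / a ^ Suc k"
    using assms by (simp add: field_simps flip: power_divide power_Suc)
  then have "(1 / (a + 1) ^ (k + 1) * S + t / (a ^ Suc k * (real k + 1))) / (a + 1)
      = 1 / (a + 1) ^ (Suc k + 1) * (S + (1 + 1 / a) ^ (k + 1) / (real k + 1) * t)"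
    using assms by (simp add: divide_simps)
  then show ?case
    using has_integral_ln_over_minus_1_mult_power_Suc[OF assms Suc.IH]
    by (simp add: S_def t_def add.assoc)
qed

end
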